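(* Let $P\in\mathcal P$, $q\geq1$ an integer, $\tau>0$ and $\alpha\in[0,1]$. Let $T(D)\in\mathbb R^q$ be a measurable function of the inferential data $D$, let $\xi\sim N(0,\tau^2I_q)$ be independent of $D$, put $W=T(D)+\xi$, and let the selected object be $S^\star=\mathcal A(W,U)$, where $U$ is a random element independent of $(D,\xi)$ and $\mathcal A$ is an arbitrary measurable map into $\mathcal S$. Assume that $\operatorname{cov}_P\{T(D)\}$ exists, and write $\Sigma_T(P)=\operatorname{cov}_P\{T(D)\}$. If the fixed-target confidence sets satisfy $$\mathrm{pr}_P\{\theta_s(P)\notin C_s(D)\}\leq\alpha,\qquad s\in\mathcal S,$$ then $$\mathrm{pr}_P\{\theta_{S^\star}(P)\notin C_{S^\star}(D)\}\leq\alpha+\left[\frac14\log\det\{I_q+\tau^{-2}\Sigma_T(P)\}\right]^{1/2}.$$ In particular, if $\operatorname{tr}\{\Sigma_T(P)\}\leq v$, then $$\mathrm{pr}_P\{\theta_{S^\star}(P)\notin C_{S^\star}(D)\}\leq\alpha+\left[\frac q4\log\left\{1+\frac{v}{q\tau^2}\right\}\right]^{1/2}.$$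
   Context: Setting. $\mathcal P$ is a class of possible distributions. Under $P\in\mathcal P$, $D$ is a random element (the inferential data) of a measurable space $\mathcal D$; $\mathcal S$ is a standard Borel space (of possible selected objects). $\mathrm{pr}_P$ and $\operatorname{cov}_P$ denote probability and covariance matrix under $P$. For each $s\in\mathcal S$, $\theta_s(P)\in\mathbb R$ is a fixed (nonrandom) target, and for each $d\in\mathcal D$, $C_s(d)\subseteq\mathbb R$ is a (confidence) set. The noncoverage set $\{(s,d):\theta_s(P)\notin C_s(d)\}\subseteq\mathcal S\times\mathcal D$ is assumed measurable for the product $\sigma$-algebra. $I_q$ is the $q\times q$ identity matrix, and $\log$ is the natural logarithm. "$\operatorname{cov}_P\{T(D)\}$ exists" means that the components of $T(D)$ have finite second moments. *)

theory Defs
  imports "HOL-Probability.Probability"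
begin

definition standard_borel :: "'a measure \<Rightarrow> bool" where
  "standard_borel S \<longleftrightarrow>
     (\<exists>X. completely_metrizable_space X \<and> second_countable X \<and>
          space S = topspace X \<and> sets S = sigma_sets (topspace X) {G. openin X G})"

text \<open>Unlike \<^const>\<open>prob_space.indep_var\<close>, the following allows the two random
  elements to take values in different types.\<close>

definition indep_random_elements ::
  "'w measure \<Rightarrow> 'a measure \<Rightarrow> ('w \<Rightarrow> 'a) \<Rightarrow> 'b measure \<Rightarrow> ('w \<Rightarrow> 'b) \<Rightarrow> bool" where
  "indep_random_elements M S X T Y \<longleftrightarrow>
     X \<in> measurable M S \<and> Y \<in> measurable M T \<and>
     prob_space.indep_set M
       {X -` A \<inter> space M | A. A \<in> sets S}
       {Y -` B \<inter> space M | B. B \<in> sets T}"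

text \<open>Density of the normal distribution with mean \<open>m\<close> and covariance matrix \<open>V\<close>.
  It is meaningful only for positive definite \<open>V\<close>.\<close>

definition mv_normal_density ::
  "real ^ 'n \<Rightarrow> real ^ 'n ^ 'n \<Rightarrow> real ^ 'n \<Rightarrow> real" where
  "mv_normal_density m V x =
     exp (- ((x - m) \<bullet> (matrix_inv V *v (x - m))) / 2) / sqrt ((2 * pi) ^ CARD('n) * det V)"

definition has_cov :: "'w measure \<Rightarrow> ('w \<Rightarrow> real ^ 'n) \<Rightarrow> bool" where
  "has_cov M X \<longleftrightarrow>
     X \<in> borel_measurable M \<and> (\<forall>i. integrable M (\<lambda>w. (X w $ i)\<^sup>2))"

definition cov_matrix :: "'w measure \<Rightarrow> ('w \<Rightarrow> real ^ 'n) \<Rightarrow> real ^ 'n ^ 'n" where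
  "cov_matrix M X =
     (\<chi> i j. \<integral>w. (X w $ i - (\<integral>w'. X w' $ i \<partial>M)) * (X w $ j - (\<integral>w'. X w' $ j \<partial>M)) \<partial>M)"

end

theory Submission
  imports Defs
begin

text \<open>
  Selection is harmless when the selected object is independent of the data: conditioning on it, the
  fixed-target guarantee bounds the error by \<open>\<alpha>\<close>. Here it depends on the data only through the
  noisy statistic \<open>W = T(D) + \<xi>\<close>, and the excess over \<open>\<alpha>\<close> is controlled by how informative \<open>W\<close> is
  about \<open>D\<close>.

  Compare the joint law of \<open>(D, W, U)\<close> with the law under which \<open>W\<close> is replaced by a variable,
  independent of \<open>D\<close> and \<open>U\<close>, with a fixed Gaussian density \<open>r\<close>. Under the second law the error
  indicator minus \<open>\<alpha>\<close> has exponential moments at most \<open>exp (l\<^sup>2 / 8)\<close> by Hoeffding's lemma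
  (\<open>nn_integral_exp_indicator_le_1\<close>, \<open>smoothed_likelihood_ratio_bound\<close>). Changing measure and using
  \<open>1 + x \<le> exp x\<close> gives, for \<open>K\<close> the Kullback-Leibler divergence of the two laws, an excess of at
  most \<open>sqrt (K / 2)\<close> (\<open>prob_excess_le_sqrt\<close>).

  For a Gaussian \<open>r\<close> the log-likelihood ratio is quadratic in \<open>W\<close> and \<open>\<xi>\<close>, so its expectation only
  involves their first and second moments, whatever the law of \<open>T(D)\<close> (\<open>selection_error_bound_reference\<close>). Taking \<open>r\<close>
  with the covariance matrix of \<open>W\<close> yields \<open>K = ln (det V) / 2\<close> with \<open>V = I + \<Sigma>\<^sub>T / \<tau>\<^sup>2\<close>; taking it
  isotropic, with variance matched to the trace bound, yields the second claim. Normalising \<open>r\<close>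
  in the first case requires a matrix \<open>B\<close> with \<open>B V B\<^sup>T = I\<close> (\<open>congruent_to_identity\<close>) and the change
  of variables \<open>x \<mapsto> B x\<close> (\<open>nn_integral_lborel_matrix\<close>).
\<close>

section \<open>Linear changes of variables for Lebesgue measure\<close>

lemma nn_integral_lborel_translate:
  fixes c :: "'a::euclidean_space" and g :: "'a \<Rightarrow> ennreal"
  assumes [measurable]: "g \<in> borel_measurable borel"
  shows "(\<integral>\<^sup>+x. g (c + x) \<partial>lborel) = (\<integral>\<^sup>+x. g x \<partial>lborel)"
proof -
  have "lborel = distr lborel borel (\<lambda>x. c + x)"
    using lborel_affine[of 1 c] by (simp add: density_1)
  then have "(\<integral>\<^sup>+x. g x \<partial>lborel) = (\<integral>\<^sup>+x. g x \<partial>distr lborel borel (\<lambda>x. c + x))"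
    by simp
  also have "\<dots> = (\<integral>\<^sup>+x. g (c + x) \<partial>lborel)"
    by (subst nn_integral_distr) simp_all
  finally show ?thesis by simp
qed

text \<open>
  On every line parallel to \<open>a\<close> the coordinate \<open>x \<bullet> b\<close> is constant, so a shear only translates such
  a line; integrating out the coordinate \<open>a\<close> first removes the shear.
\<close>

lemma nn_integral_lborel_shear:
  fixes a b :: "'a::euclidean_space" and g :: "'a \<Rightarrow> ennreal"
  assumes a: "a \<in> Basis" and b: "b \<in> Basis" and ab: "a \<noteq> b"
    and [measurable]: "g \<in> borel_measurable borel"
  shows "(\<integral>\<^sup>+x. g (x + (x \<bullet> b) *\<^sub>R a) \<partial>lborel) = (\<integral>\<^sup>+x. g x \<partial>lborel)"
proof -
  interpret product_sigma_finite "\<lambda>_::'a. lborel :: real measure"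
    by standard
  define R where "R = Basis - {a}"
  have R: "finite R" "a \<notin> R" "insert a R = Basis" "b \<in> R"
    using a b ab by (auto simp: R_def)
  define e where "e x = (\<Sum>c\<in>R. x c *\<^sub>R c)" for x :: "'a \<Rightarrow> real"
  have [measurable]: "(\<lambda>x. \<Sum>c\<in>Basis. x c *\<^sub>R c) \<in> borel_measurable (Pi\<^sub>M Basis (\<lambda>_::'a. lborel))"
    by measurable
  have split: "(\<integral>\<^sup>+x. h x \<partial>lborel) = (\<integral>\<^sup>+x. \<integral>\<^sup>+y. h (y *\<^sub>R a + e x) \<partial>lborel \<partial>Pi\<^sub>M R (\<lambda>_. lborel))"
    if [measurable]: "h \<in> borel_measurable borel" for h :: "'a \<Rightarrow> ennreal"
  proof -
    have "(\<integral>\<^sup>+x. h x \<partial>lborel) = (\<integral>\<^sup>+x. h (\<Sum>c\<in>Basis. x c *\<^sub>R c) \<partial>Pi\<^sub>M Basis (\<lambda>_. lborel))"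
      unfolding lborel_def[where 'a='a] lborel_eq_real[symmetric]
      by (subst nn_integral_distr) (simp_all)
    also have "\<dots> = (\<integral>\<^sup>+x. h (\<Sum>c\<in>insert a R. x c *\<^sub>R c) \<partial>Pi\<^sub>M (insert a R) (\<lambda>_. lborel))"
      by (simp only: R(3))
    also have "\<dots> = (\<integral>\<^sup>+x. \<integral>\<^sup>+y. h (\<Sum>c\<in>insert a R. (x(a := y)) c *\<^sub>R c) \<partial>lborel \<partial>Pi\<^sub>M R (\<lambda>_. lborel))"
      using R by (intro product_nn_integral_insert) simp_all
    also have "\<dots> = (\<integral>\<^sup>+x. \<integral>\<^sup>+y. h (y *\<^sub>R a + e x) \<partial>lborel \<partial>Pi\<^sub>M R (\<lambda>_. lborel))"
    proof (intro nn_integral_cong)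
      fix x :: "'a \<Rightarrow> real" and y :: real
      have "(\<Sum>c\<in>R. (x(a := y)) c *\<^sub>R c) = e x"
        unfolding e_def using R(2) by (intro sum.cong) auto
      then have "(\<Sum>c\<in>insert a R. (x(a := y)) c *\<^sub>R c) = y *\<^sub>R a + e x"
        by (subst sum.insert) (use R in simp_all)
      then show "h (\<Sum>c\<in>insert a R. (x(a := y)) c *\<^sub>R c) = h (y *\<^sub>R a + e x)"
        by (rule arg_cong)
    qed
    finally show ?thesis .
  qed
  have inner_b: "(y *\<^sub>R a + e x) \<bullet> b = x b" for x y
  proof -
    have "e x \<bullet> b = (\<Sum>c\<in>R. if c = b then x b else 0)"
      unfolding e_def inner_sum_left using R b
      by (intro sum.cong) (auto simp: inner_Basis)
    then show ?thesis
      using a b ab R by (simp add: inner_add_left inner_Basis)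
  qed
  have "(\<integral>\<^sup>+x. g (x + (x \<bullet> b) *\<^sub>R a) \<partial>lborel) =
      (\<integral>\<^sup>+x. \<integral>\<^sup>+y. g ((x b + y) *\<^sub>R a + e x) \<partial>lborel \<partial>Pi\<^sub>M R (\<lambda>_. lborel))"
  proof (subst split)
    have "(y *\<^sub>R a + e x) + ((y *\<^sub>R a + e x) \<bullet> b) *\<^sub>R a = (x b + y) *\<^sub>R a + e x" for x y
      unfolding inner_b by (simp add: scaleR_add_left)
    then show "(\<integral>\<^sup>+x. \<integral>\<^sup>+y. g ((y *\<^sub>R a + e x) + ((y *\<^sub>R a + e x) \<bullet> b) *\<^sub>R a) \<partial>lborel \<partial>Pi\<^sub>M R (\<lambda>_. lborel)) =
      (\<integral>\<^sup>+x. \<integral>\<^sup>+y. g ((x b + y) *\<^sub>R a + e x) \<partial>lborel \<partial>Pi\<^sub>M R (\<lambda>_. lborel))"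
      by (simp only:)
  qed measurable
  also have "\<dots> = (\<integral>\<^sup>+x. \<integral>\<^sup>+y. g (y *\<^sub>R a + e x) \<partial>lborel \<partial>Pi\<^sub>M R (\<lambda>_. lborel))"
    by (intro nn_integral_cong nn_integral_lborel_translate) measurable
  also have "\<dots> = (\<integral>\<^sup>+x. g x \<partial>lborel)"
    by (rule split[symmetric]) simp
  finally show ?thesis .
qed

lemma Basis_cart: "Basis = range (\<lambda>i. axis i (1::real))"
  by (auto simp: Basis_vec_def)

lemma prod_Basis_cart: "(\<Prod>b\<in>Basis. f b) = (\<Prod>i\<in>UNIV. f (axis i (1::real)))"
  unfolding Basis_cart by (subst prod.reindex) (auto simp: inj_on_def axis_eq_axis)

lemma nn_integral_lborel_swap:
  fixes g :: "real^'n \<Rightarrow> ennreal"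
  assumes [measurable]: "g \<in> borel_measurable borel"
  shows "(\<integral>\<^sup>+x. g (\<chi> i. x $ Transposition.transpose m n i) \<partial>lborel) = (\<integral>\<^sup>+x. g x \<partial>lborel)"
proof -
  let ?h = "\<lambda>x::real^'n. \<chi> i. x $ Transposition.transpose m n i"
  have [measurable]: "?h \<in> borel_measurable borel"
    by (intro borel_measurable_continuous_onI continuous_intros)
  have "lborel = distr lborel borel ?h"
  proof (rule lborel_eqI)
    fix l u :: "real^'n"
    assume le: "\<And>b. b \<in> Basis \<Longrightarrow> l \<bullet> b \<le> u \<bullet> b"
    have le': "l $ i \<le> u $ i" for i
      using le[of "axis i 1"] by (simp add: inner_axis Basis_cart)
    have eq: "?h -` box l u \<inter> space lborel = box (?h l) (?h u)"
      by (auto simp: mem_box_cart) (metis transpose_involutory)+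
    have "emeasure (distr lborel borel ?h) (box l u) = emeasure lborel (box (?h l) (?h u))"
      by (subst emeasure_distr) (simp_all add: eq[simplified])
    also have "\<dots> = (\<Prod>b\<in>Basis. (?h u - ?h l) \<bullet> b)"
      using le' by (intro emeasure_lborel_box) (auto simp: Basis_cart inner_axis)
    also have "(\<Prod>b\<in>Basis. (?h u - ?h l) \<bullet> b) = (\<Prod>i\<in>UNIV. (u - l) $ Transposition.transpose m n i)"
      unfolding prod_Basis_cart by (simp add: inner_axis)
    also have "\<dots> = (\<Prod>i\<in>UNIV. (u - l) $ i)"
      using prod.permute[OF permutes_swap_id, of m UNIV n "\<lambda>i. (u - l) $ i"] by (simp add: o_def)
    also have "\<dots> = (\<Prod>b\<in>Basis. (u - l) \<bullet> b)"
      unfolding prod_Basis_cart by (simp add: inner_axis)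
    finally show "emeasure (distr lborel borel ?h) (box l u) = (\<Prod>b\<in>Basis. (u - l) \<bullet> b)" .
  qed simp
  then have "(\<integral>\<^sup>+x. g x \<partial>lborel) = (\<integral>\<^sup>+x. g x \<partial>distr lborel borel ?h)"
    by simp
  also have "\<dots> = (\<integral>\<^sup>+x. g (?h x) \<partial>lborel)"
    by (subst nn_integral_distr) simp_all
  finally show ?thesis by simp
qed

lemma borel_measurable_matrix_vector_mult [measurable]:
  "(\<lambda>x. (A::real^'n^'m) *v x) \<in> borel_measurable borel"
  by (intro borel_measurable_continuous_onI matrix_vector_mult_linear_continuous_on)

text \<open>
  The statement is closed under matrix products, since substitutions compose and determinants
  multiply, so it suffices to check elementary matrices: diagonal ones rescale the coordinates, transpositions permute them,
  and shears preserve the measure and have determinant one. A matrix with a zero row is singular.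
\<close>

lemma nn_integral_lborel_matrix:
  fixes A :: "real^'n^'n" and g :: "real^'n \<Rightarrow> ennreal"
  assumes "det A \<noteq> 0" and "g \<in> borel_measurable borel"
  shows "ennreal \<bar>det A\<bar> * (\<integral>\<^sup>+x. g (A *v x) \<partial>lborel) = (\<integral>\<^sup>+x. g x \<partial>lborel)"
proof -
  define Q where "Q A \<longleftrightarrow> (det A \<noteq> 0 \<longrightarrow> (\<forall>g\<in>borel_measurable borel.
    ennreal \<bar>det A\<bar> * (\<integral>\<^sup>+x. g (A *v x) \<partial>lborel) = (\<integral>\<^sup>+x. g x \<partial>lborel)))" for A :: "real^'n^'n"
  have "Q A"
  proof (rule induct_matrix_elementary_alt)
    fix A B :: "real^'n^'n"
    assume A: "Q A" and B: "Q B"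
    show "Q (A ** B)"
      unfolding Q_def
    proof (intro impI ballI)
      fix g :: "real^'n \<Rightarrow> ennreal"
      assume det: "det (A ** B) \<noteq> 0" and g[measurable]: "g \<in> borel_measurable borel"
      have "ennreal \<bar>det (A ** B)\<bar> * (\<integral>\<^sup>+x. g ((A ** B) *v x) \<partial>lborel)
          = ennreal \<bar>det A\<bar> * (ennreal \<bar>det B\<bar> * (\<integral>\<^sup>+x. g (A *v (B *v x)) \<partial>lborel))"
        by (simp add: det_mul abs_mult ennreal_mult matrix_vector_mul_assoc mult.assoc)
      also have "ennreal \<bar>det B\<bar> * (\<integral>\<^sup>+x. g (A *v (B *v x)) \<partial>lborel) = (\<integral>\<^sup>+x. g (A *v x) \<partial>lborel)"
        using B det by (auto simp: Q_def det_mul)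
      also have "ennreal \<bar>det A\<bar> * \<dots> = (\<integral>\<^sup>+x. g x \<partial>lborel)"
        using A det by (auto simp: Q_def det_mul)
      finally show "ennreal \<bar>det (A ** B)\<bar> * (\<integral>\<^sup>+x. g ((A ** B) *v x) \<partial>lborel) = (\<integral>\<^sup>+x. g x \<partial>lborel)" .
    qed
  next
    fix A :: "real^'n^'n" and i
    assume "row i A = 0"
    then show "Q A"
      by (simp add: Q_def det_zero_row)
  next
    fix A :: "real^'n^'n"
    assume diag: "\<And>i j. i \<noteq> j \<Longrightarrow> A $ i $ j = 0"
    define c where "c b = (A *v b) \<bullet> b" for b
    have c: "c (axis i 1) = A $ i $ i" for i
      by (simp add: c_def inner_axis matrix_vector_mult_basis column_def)
    have detA: "det A = (\<Prod>i\<in>UNIV. A $ i $ i)"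
      using diag by (rule det_diagonal)
    have Ax: "A *v x = 0 + (\<Sum>b\<in>Basis. (c b * (x \<bullet> b)) *\<^sub>R b)" for x
    proof -
      have "(A *v x) $ i = A $ i $ i * x $ i" for i
      proof -
        have "(A *v x) $ i = (\<Sum>j\<in>UNIV. if j = i then A $ i $ i * x $ i else 0)"
          unfolding matrix_vector_mult_def vec_lambda_beta using diag by (intro sum.cong) auto
        then show ?thesis by simp
      qed
      moreover have "(\<Sum>b\<in>Basis. (c b * (x \<bullet> b)) *\<^sub>R b) $ i = A $ i $ i * x $ i" for i
      proof -
        have "(\<Sum>b\<in>Basis. (c b * (x \<bullet> b)) *\<^sub>R b) \<bullet> axis i 1 = c (axis i 1) * (x \<bullet> axis i 1)"
          by (rule inner_sum_left_Basis) (simp add: Basis_cart)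
        then show ?thesis by (simp add: inner_axis c)
      qed
      ultimately show ?thesis by (simp add: vec_eq_iff)
    qed
    show "Q A"
      unfolding Q_def
    proof (intro impI ballI)
      fix g :: "real^'n \<Rightarrow> ennreal"
      assume det: "det A \<noteq> 0" and g[measurable]: "g \<in> borel_measurable borel"
      have nz: "c j \<noteq> 0" if "j \<in> Basis" for j
        using that det unfolding detA by (auto simp: Basis_cart c)
      have prod_c: "(\<Prod>j\<in>Basis. \<bar>c j\<bar>) = \<bar>det A\<bar>"
        unfolding prod_Basis_cart c detA by (simp add: abs_prod)
      have "lborel = density (distr lborel borel (\<lambda>x. A *v x)) (\<lambda>_. ennreal \<bar>det A\<bar>)"
        using lborel_affine_euclidean[of c 0, OF nz] unfolding Ax[symmetric] prod_c .
      then have "(\<integral>\<^sup>+x. g x \<partial>lborel) = (\<integral>\<^sup>+x. g x \<partial>density (distr lborel borel (\<lambda>x. A *v x)) (\<lambda>_. ennreal \<bar>det A\<bar>))"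
        by simp
      also have "\<dots> = ennreal \<bar>det A\<bar> * (\<integral>\<^sup>+x. g (A *v x) \<partial>lborel)"
        by (simp add: nn_integral_density nn_integral_distr nn_integral_cmult)
      finally show "ennreal \<bar>det A\<bar> * (\<integral>\<^sup>+x. g (A *v x) \<partial>lborel) = (\<integral>\<^sup>+x. g x \<partial>lborel)" by simp
    qed
  next
    fix m n :: 'n
    let ?A = "(\<chi> i j. mat 1 $ i $ Transposition.transpose m n j) :: real^'n^'n"
    have 1: "\<bar>det ?A\<bar> = 1"
      by (subst det_permute_columns) (auto simp: permutes_swap_id sign_swap_id abs_mult)
    have "(?A *v x) $ i = x $ Transposition.transpose m n i" for x i
    proof -
      have "(?A *v x) $ i = (\<Sum>j\<in>UNIV. if j = Transposition.transpose m n i then x $ j else 0)"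
        unfolding matrix_vector_mult_def
          vec_lambda_beta mat_def
        by (intro sum.cong) (auto simp: transpose_eq_iff)
      then show ?thesis by simp
    qed
    then have "?A *v x = (\<chi> i. x $ Transposition.transpose m n i)" for x
      by (simp add: vec_eq_iff)
    with 1 show "Q ?A"
      by (simp add: Q_def nn_integral_lborel_swap)
  next
    fix m n :: 'n
    assume mn: "m \<noteq> n"
    let ?A = "(\<chi> i j. of_bool (i = m \<and> j = n \<or> i = j)) :: real^'n^'n"
    have "?A = (\<chi> k. if k = m then row m (mat 1) + 1 *s row n (mat 1) else row k (mat 1))"
      using mn by (auto simp: vec_eq_iff row_def mat_def)
    then have 1: "det ?A = 1"
      using det_row_operation[OF mn, of "mat 1 :: real^'n^'n" 1] by simp
    have "(?A *v x) $ i = (x + (x \<bullet> axis n 1) *\<^sub>R axis m 1) $ i" for x :: "real^'n" and i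
    proof -
      have "(?A *v x) $ i = (\<Sum>j\<in>UNIV. (if j = i then x $ j else 0) + (if j = n then (if i = m then x $ j else 0) else 0))"
        unfolding matrix_vector_mult_def using mn by (auto intro!: sum.cong)
      also have "\<dots> = x $ i + (if i = m then x $ n else 0)"
        by (simp add: sum.distrib)
      also have "\<dots> = (x + (x \<bullet> axis n 1) *\<^sub>R axis m 1) $ i"
        by (simp add: inner_axis) (simp add: axis_def)
      finally show ?thesis .
    qed
    then have A: "?A *v x = x + (x \<bullet> axis n 1) *\<^sub>R axis m 1" for x
      by (simp add: vec_eq_iff)
    show "Q ?A"
      unfolding Q_def A 1 using mn
      by (auto simp: Basis_cart axis_eq_axis intro!: nn_integral_lborel_shear)
  qed
  with assms show ?thesis by (auto simp: Q_def)
qed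

section \<open>Positive definite matrices\<close>

text \<open>
  The rows of \<open>B\<close> are an orthonormal basis for the inner product \<open>x \<bullet> (V *v y)\<close>, found one vector at
  a time: the vectors \<open>V *v b i\<close> chosen so far span a proper subspace, so some nonzero \<open>x\<close> is
  orthogonal to all of them, that is, \<open>V\<close>-orthogonal to all \<open>b i\<close>; normalising \<open>x\<close> gives the next
  row.
\<close>

lemma congruent_to_identity:
  fixes V :: "real^'n^'n"
  assumes sym: "transpose V = V" and pos: "\<And>x. x \<noteq> 0 \<Longrightarrow> 0 < x \<bullet> (V *v x)"
  shows "\<exists>B::real^'n^'n. B ** V ** transpose B = mat 1"
proof -
  have comm: "x \<bullet> (V *v y) = y \<bullet> (V *v x)" for x y
    by (metis dot_lmul_matrix inner_commute sym transpose_matrix_vector)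
  have "\<exists>b :: 'n \<Rightarrow> real^'n. \<forall>i\<in>S. \<forall>j\<in>S. b i \<bullet> (V *v b j) = of_bool (i = j)" for S :: "'n set"
    using finite[of S]
  proof (induction S rule: finite_induct)
    case (insert k S)
    then obtain b :: "'n \<Rightarrow> real^'n"
      where b: "\<And>i j. i \<in> S \<Longrightarrow> j \<in> S \<Longrightarrow> b i \<bullet> (V *v b j) = of_bool (i = j)"
      by blast
    let ?X = "(\<lambda>i. V *v b i) ` S"
    have "dim ?X \<le> card S"
      by (meson dim_le_card' finite_imageI insert.hyps(1) card_image_le order_trans)
    also have "card S < CARD('n)"
      using insert.hyps by (intro psubset_card_mono) auto
    finally obtain x where x: "x \<noteq> 0" "\<And>y. y \<in> span ?X \<Longrightarrow> orthogonal x y"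
      using orthogonal_to_subspace_exists[of ?X] by auto
    define y where "y = (1 / sqrt (x \<bullet> (V *v x))) *\<^sub>R x"
    have yy: "y \<bullet> (V *v y) = 1"
      using pos[OF x(1)] by (simp add: y_def matrix_vector_mult_scaleR real_div_sqrt)
    have yb: "y \<bullet> (V *v b i) = 0" if "i \<in> S" for i
      using x(2)[of "V *v b i"] that by (simp add: y_def span_base orthogonal_def)
    have "(b(k := y)) i \<bullet> (V *v (b(k := y)) j) = of_bool (i = j)"
      if "i \<in> insert k S" "j \<in> insert k S" for i j
      using that insert.hyps(2) b yy yb comm[of "b i" y] by (cases "i = k"; cases "j = k") auto
    then show ?case by blast
  qed simp
  from this[of UNIV] obtain b :: "'n \<Rightarrow> real^'n" where b: "\<And>i j. b i \<bullet> (V *v b j) = of_bool (i = j)"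
    by blast
  define B :: "real^'n^'n" where "B = (\<chi> i. b i)"
  have "(B ** V ** transpose B) $ i $ j = b i \<bullet> (V *v b j)" for i j
    by (simp add: B_def matrix_mul_assoc[symmetric])
       (simp add: matrix_matrix_mult_def matrix_vector_mult_def inner_vec_def transpose_def)
  then have "B ** V ** transpose B = mat 1"
    by (simp add: vec_eq_iff b mat_def)
  then show ?thesis ..
qed

section \<open>From exponential moments to probabilities\<close>

text \<open>
  Hoeffding's lemma for an event. A Bernoulli variable with success probability \<open>p\<close> has logarithmic
  moment generating function at most \<open>l * p + l\<^sup>2 / 8\<close>; as \<open>l\<close> is nonnegative, \<open>p\<close> may be replaced by
  the upper bound \<open>\<alpha>\<close>.
\<close>

lemma (in prob_space) nn_integral_exp_indicator_le_1:
  assumes A: "A \<in> events" and le: "prob A \<le> \<alpha>" and l: "0 \<le> l"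
  shows "(\<integral>\<^sup>+x. ennreal (exp (l * (indicator A x - \<alpha>) - l\<^sup>2 / 8)) \<partial>M) \<le> 1"
proof -
  define p where "p = prob A"
  have I: "integrable M (indicator A :: _ \<Rightarrow> real)"
    using A by (simp add: less_top[symmetric])
  have p: "0 \<le> p" "p \<le> \<alpha>" using le by (auto simp: p_def)
  define c where "c = exp (- (l * \<alpha>) - l\<^sup>2 / 8)"
  have "exp (l * (indicator A x - \<alpha>) - l\<^sup>2 / 8) = c * (1 + indicator A x * (exp l - 1))" for x
    by (auto simp: c_def indicator_def right_diff_distrib simp flip: exp_add)
  then have "(\<integral>\<^sup>+x. ennreal (exp (l * (indicator A x - \<alpha>) - l\<^sup>2 / 8)) \<partial>M)
      = (\<integral>\<^sup>+x. ennreal (c * (1 + indicator A x * (exp l - 1))) \<partial>M)" by simp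
  also have "\<dots> = ennreal (\<integral>x. c * (1 + indicator A x * (exp l - 1)) \<partial>M)"
    using l I by (intro nn_integral_eq_integral integrable_mult_right Bochner_Integration.integrable_add
        integrable_mult_left) (auto simp: c_def)
  also have "(\<integral>x. c * (1 + indicator A x * (exp l - 1)) \<partial>M) = c * (1 + p * (exp l - 1))"
    using I A by (simp add: p_def prob_space)
  also have "c * (1 + p * (exp l - 1)) \<le> 1"
  proof -
    have pos: "1 + p * (exp l - 1) > 0"
      using p l by (intro add_pos_nonneg mult_nonneg_nonneg) auto
    have "ln (1 + p * (exp l - 1)) \<le> l * p + l\<^sup>2 / 8"
      using Hoeffdings_lemma_aux[OF l p(1)] by simp
    also have "\<dots> \<le> l * \<alpha> + l\<^sup>2 / 8"
      using p l by (simp add: mult_left_mono)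
    finally have "1 + p * (exp l - 1) \<le> exp (l * \<alpha> + l\<^sup>2 / 8)"
      using pos by (metis exp_le_cancel_iff exp_ln)
    then have "c * (1 + p * (exp l - 1)) \<le> c * exp (l * \<alpha> + l\<^sup>2 / 8)"
      by (intro mult_left_mono) (simp_all add: c_def)
    also have "\<dots> = 1"
      by (simp add: c_def flip: exp_add)
    finally show ?thesis .
  qed
  finally show ?thesis by (simp add: ennreal_leI)
qed

text \<open>
  The form of Pinsker's inequality that the argument needs. When \<open>L\<close> is the logarithm of a likelihood
  ratio \<open>dM/dR\<close>, the hypothesis is the sub-Gaussian bound for the event under \<open>R\<close>, transported to
  \<open>M\<close>, and \<open>expectation L\<close> is the Kullback-Leibler divergence of \<open>M\<close> from \<open>R\<close>. Applying
  \<open>1 + x \<le> exp x\<close> under the integral gives a bound on the excess probability that is quadratic in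
  \<open>l\<close>, which is then optimised.
\<close>

lemma (in prob_space) prob_excess_le_sqrt:
  assumes A: "A \<in> events" and L: "integrable M L"
    and mgf: "\<And>l. 0 \<le> l \<Longrightarrow>
      (\<integral>\<^sup>+x. ennreal (exp (l * (indicator A x - \<alpha>) - l\<^sup>2 / 8 - L x)) \<partial>M) \<le> 1"
  shows "prob A - \<alpha> \<le> sqrt (expectation L / 2)"
proof -
  have I: "integrable M (indicator A :: _ \<Rightarrow> real)"
    using A by (simp add: less_top[symmetric])
  have key: "l * (prob A - \<alpha>) - l\<^sup>2 / 8 \<le> expectation L" if l: "0 \<le> l" for l
  proof -
    let ?X = "\<lambda>x. l * (indicator A x - \<alpha>) - l\<^sup>2 / 8 - L x"
    have X: "integrable M ?X"
      using I L by (intro Bochner_Integration.integrable_diff integrable_mult_right) auto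
    have E: "integrable M (\<lambda>x. exp (?X x))"
      by (rule integrableI_bounded)
         (use A L mgf[OF l] in \<open>auto simp: order.strict_trans1[OF _ ennreal_one_less_top]\<close>)
    have "expectation ?X + 1 = expectation (\<lambda>x. 1 + ?X x)"
      using X by (simp add: prob_space)
    also have "\<dots> \<le> expectation (\<lambda>x. exp (?X x))"
      using X E by (intro integral_mono exp_ge_add_one_self) auto
    also have "\<dots> \<le> 1"
      using mgf[OF l] E by (simp add: nn_integral_eq_integral)
    finally have "expectation ?X \<le> 0" by simp
    also have "expectation ?X = l * (prob A - \<alpha>) - l\<^sup>2 / 8 - expectation L"
      using A I L by (simp add: prob_space)
    finally show ?thesis by simp
  qed
  show ?thesis
  proof (cases "prob A \<le> \<alpha>")
    case True
    \<comment> \<open>At \<open>l = 0\<close> the bound says that the divergence is nonnegative.\<close>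
    have "0 \<le> expectation L" using key[of 0] by simp
    then have "0 \<le> sqrt (expectation L / 2)" by simp
    with True show ?thesis by linarith
  next
    case False
    \<comment> \<open>The bound \<open>l * d - l\<^sup>2 / 8\<close> is largest at \<open>l = 4 * d\<close>.\<close>
    define d where "d = prob A - \<alpha>"
    have "4 * d * d - (4 * d)\<^sup>2 / 8 = 2 * d\<^sup>2" by (simp add: power2_eq_square)
    then have "2 * (prob A - \<alpha>)\<^sup>2 \<le> expectation L"
      using key[of "4 * d"] False by (simp add: d_def)
    then show ?thesis by (intro real_le_rsqrt) simp
  qed
qed

section \<open>Independent random elements\<close>

lemma indep_random_elements_distr:
  assumes M: "prob_space M" and ind: "indep_random_elements M S X T Y"
  shows "distr M S X \<Otimes>\<^sub>M distr M T Y = distr M (S \<Otimes>\<^sub>M T) (\<lambda>w. (X w, Y w))"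
proof -
  interpret prob_space M by fact
  have X[measurable]: "X \<in> measurable M S" and Y[measurable]: "Y \<in> measurable M T"
    and indep: "indep_set {X -` A \<inter> space M | A. A \<in> sets S} {Y -` B \<inter> space M | B. B \<in> sets T}"
    using ind by (auto simp: indep_random_elements_def)
  interpret X: prob_space "distr M S X" by (rule prob_space_distr) fact
  interpret Y: prob_space "distr M T Y" by (rule prob_space_distr) fact
  show ?thesis
  proof (rule pair_measure_eqI)
    fix A B assume A: "A \<in> sets (distr M S X)" and B: "B \<in> sets (distr M T Y)"
    have "prob ((X -` A \<inter> space M) \<inter> (Y -` B \<inter> space M)) = prob (X -` A \<inter> space M) * prob (Y -` B \<inter> space M)"
      using indep A B by (intro indep_setD) auto
    moreover have "(\<lambda>w. (X w, Y w)) -` (A \<times> B) \<inter> space M = (X -` A \<inter> space M) \<inter> (Y -` B \<inter> space M)"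
      by auto
    ultimately show "emeasure (distr M S X) A * emeasure (distr M T Y) B
        = emeasure (distr M (S \<Otimes>\<^sub>M T) (\<lambda>w. (X w, Y w))) (A \<times> B)"
      using A B by (simp add: emeasure_distr emeasure_eq_measure ennreal_mult)
  qed (auto intro: X.sigma_finite_measure_axioms Y.sigma_finite_measure_axioms)
qed

lemma indep_random_elements_compose:
  assumes M: "prob_space M" and ind: "indep_random_elements M S X T Y"
    and f[measurable]: "f \<in> measurable S S'" and g[measurable]: "g \<in> measurable T T'"
  shows "indep_random_elements M S' (\<lambda>w. f (X w)) T' (\<lambda>w. g (Y w))"
proof -
  interpret prob_space M by fact
  have X[measurable]: "X \<in> measurable M S" and Y[measurable]: "Y \<in> measurable M T"
    and indep: "indep_set {X -` A \<inter> space M | A. A \<in> sets S} {Y -` B \<inter> space M | B. B \<in> sets T}"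
    using ind by (auto simp: indep_random_elements_def)
  have fX: "\<exists>A'\<in>sets S. (\<lambda>w. f (X w)) -` A \<inter> space M = X -` A' \<inter> space M" if "A \<in> sets S'" for A
    using that measurable_space[OF X] by (intro bexI[of _ "f -` A \<inter> space S"]) auto
  have gY: "\<exists>B'\<in>sets T. (\<lambda>w. g (Y w)) -` B \<inter> space M = Y -` B' \<inter> space M" if "B \<in> sets T'" for B
    using that measurable_space[OF Y] by (intro bexI[of _ "g -` B \<inter> space T"]) auto
  have "indep_set {(\<lambda>w. f (X w)) -` A \<inter> space M | A. A \<in> sets S'} {(\<lambda>w. g (Y w)) -` B \<inter> space M | B. B \<in> sets T'}"
    using indep unfolding indep_set_def
    by (rule indep_sets_mono_sets) (use fX gY in \<open>fastforce split: bool.splits\<close>)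
  then show ?thesis by (simp add: indep_random_elements_def)
qed

lemma indep_random_elements_integral_mult:
  fixes f g :: "_ \<Rightarrow> real"
  assumes M: "prob_space M" and ind: "indep_random_elements M S X T Y"
    and [measurable]: "f \<in> borel_measurable S" "g \<in> borel_measurable T"
    and f: "integrable M (\<lambda>w. f (X w))" and g: "integrable M (\<lambda>w. g (Y w))"
  shows "integrable M (\<lambda>w. f (X w) * g (Y w))"
    and "(\<integral>w. f (X w) * g (Y w) \<partial>M) = (\<integral>w. f (X w) \<partial>M) * (\<integral>w. g (Y w) \<partial>M)"
proof -
  interpret prob_space M by fact
  have i: "indep_random_elements M borel (\<lambda>w. f (X w)) borel (\<lambda>w. g (Y w))"
    by (rule indep_random_elements_compose[OF M ind]) simp_all
  then have "indep_var borel (\<lambda>w. f (X w)) borel (\<lambda>w. g (Y w))"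
    using indep_random_elements_distr[OF M i]
    by (auto simp: indep_var_distribution_eq indep_random_elements_def)
  then show "integrable M (\<lambda>w. f (X w) * g (Y w))"
    "(\<integral>w. f (X w) * g (Y w) \<partial>M) = (\<integral>w. f (X w) \<partial>M) * (\<integral>w. g (Y w) \<partial>M)"
    using f g by (auto intro: indep_var_integrable indep_var_lebesgue_integral)
qed

section \<open>Moments of the isotropic normal distribution\<close>

lemma lborel_integral_prod:
  fixes f :: "'a::euclidean_space \<Rightarrow> real \<Rightarrow> real"
  assumes f: "\<And>b. b \<in> Basis \<Longrightarrow> integrable lborel (f b)"
  shows "integrable lborel (\<lambda>x. \<Prod>b\<in>Basis. f b (x \<bullet> b))"
    and "(\<integral>x. (\<Prod>b\<in>Basis. f b (x \<bullet> b)) \<partial>lborel) = (\<Prod>b\<in>Basis. \<integral>x. f b x \<partial>lborel)"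
proof -
  interpret product_sigma_finite "\<lambda>_::'a. lborel :: real measure"
    by standard
  let ?P = "Pi\<^sub>M Basis (\<lambda>_::'a. lborel :: real measure)"
  have [measurable]: "f b \<in> borel_measurable borel" if "b \<in> Basis" for b
    using f[OF that] by (auto dest: borel_measurable_integrable)
  have lb: "lborel = distr ?P borel (\<lambda>x. \<Sum>c\<in>Basis. x c *\<^sub>R c)"
    unfolding lborel_def[where 'a='a] lborel_eq_real[symmetric] ..
  have m: "(\<lambda>x. \<Sum>c\<in>Basis. x c *\<^sub>R c) \<in> borel_measurable ?P" by measurable
  have coord: "(\<Sum>c\<in>Basis. x c *\<^sub>R c) \<bullet> b = x b" if "b \<in> Basis" for x and b :: 'a
    using that by (rule inner_sum_left_Basis)
  have eq: "(\<Prod>b\<in>Basis. f b ((\<Sum>c\<in>Basis. x c *\<^sub>R c) \<bullet> b)) = (\<Prod>b\<in>Basis. f b (x b))" for x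
    by (intro prod.cong) (simp_all add: coord)
  show "integrable lborel (\<lambda>x. \<Prod>b\<in>Basis. f b (x \<bullet> b))"
    unfolding lb by (subst integrable_distr_eq[OF m]) (simp_all add: eq product_integrable_prod f)
  show "(\<integral>x. (\<Prod>b\<in>Basis. f b (x \<bullet> b)) \<partial>lborel) = (\<Prod>b\<in>Basis. \<integral>x. f b x \<partial>lborel)"
    unfolding lb by (subst integral_distr[OF m]) (simp_all add: eq product_integral_prod f)
qed

lemma isotropic_normal_density_eq:
  fixes x :: "real^'n"
  assumes t: "0 < \<tau>"
  shows "mv_normal_density 0 (\<tau>\<^sup>2 *\<^sub>R mat 1) x = exp (- (norm x)\<^sup>2 / (2 * \<tau>\<^sup>2)) / sqrt (2 * pi * \<tau>\<^sup>2) ^ CARD('n)"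
proof -
  have det: "det (\<tau>\<^sup>2 *\<^sub>R mat 1 :: real^'n^'n) = (\<tau>\<^sup>2) ^ CARD('n)"
    by (subst det_diagonal) (simp_all add: mat_def)
  have "matrix_inv (\<tau>\<^sup>2 *\<^sub>R mat 1 :: real^'n^'n) = (1 / \<tau>\<^sup>2) *\<^sub>R mat 1"
    unfolding matrix_inv_def
  proof (rule some_equality)
    show "(\<tau>\<^sup>2 *\<^sub>R mat 1) ** ((1 / \<tau>\<^sup>2) *\<^sub>R mat 1) = (mat 1 :: real^'n^'n) \<and>
        ((1 / \<tau>\<^sup>2) *\<^sub>R mat 1) ** (\<tau>\<^sup>2 *\<^sub>R mat 1) = (mat 1 :: real^'n^'n)"
      using t by (simp flip: scalar_matrix_assoc)
  next
    fix B :: "real^'n^'n"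
    assume "(\<tau>\<^sup>2 *\<^sub>R mat 1) ** B = mat 1 \<and> B ** (\<tau>\<^sup>2 *\<^sub>R mat 1) = mat 1"
    then have "\<tau>\<^sup>2 *\<^sub>R B = mat 1"
      by (simp flip: scalar_matrix_assoc)
    then have "(1 / \<tau>\<^sup>2) *\<^sub>R (\<tau>\<^sup>2 *\<^sub>R B) = (1 / \<tau>\<^sup>2) *\<^sub>R mat 1"
      by simp
    then show "B = (1 / \<tau>\<^sup>2) *\<^sub>R mat 1"
      using t by simp
  qed
  moreover have "sqrt ((2 * pi) ^ CARD('n) * (\<tau>\<^sup>2) ^ CARD('n)) = sqrt (2 * pi * \<tau>\<^sup>2) ^ CARD('n)"
    by (simp only: power_mult_distrib[symmetric] real_sqrt_power)
  ultimately show ?thesis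
    by (simp only: mv_normal_density_def det)
       (simp add: scaleR_matrix_vector_assoc[symmetric] power2_norm_eq_inner mult.commute)
qed

lemma isotropic_normal_density_eq_prod:
  fixes x :: "real^'n"
  assumes t: "0 < \<tau>"
  shows "mv_normal_density 0 (\<tau>\<^sup>2 *\<^sub>R mat 1) x = (\<Prod>b\<in>Basis. normal_density 0 \<tau> (x \<bullet> b))"
proof -
  have "(norm x)\<^sup>2 = (\<Sum>b\<in>Basis. (x \<bullet> b)\<^sup>2)"
    by (subst power2_norm_eq_inner, subst euclidean_inner) (simp add: power2_eq_square)
  then have "(\<Prod>b\<in>Basis. exp (- (x \<bullet> b)\<^sup>2 / (2 * \<tau>\<^sup>2))) = exp (- (norm x)\<^sup>2 / (2 * \<tau>\<^sup>2))"
    by (simp add: exp_sum[symmetric] sum_negf sum_divide_distrib)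
  then show ?thesis
    by (simp add: isotropic_normal_density_eq[OF t] normal_density_def prod.distrib prod_dividef)
qed

text \<open>
  Both the density and the monomial are products over the coordinates, so every mixed moment is the
  product of one-dimensional normal moments.
\<close>

lemma isotropic_normal_moment:
  fixes X :: "'w \<Rightarrow> real^'n" and k :: "real^'n \<Rightarrow> nat"
  assumes t: "0 < \<tau>"
    and X: "distributed M lborel X (\<lambda>x. ennreal (mv_normal_density 0 (\<tau>\<^sup>2 *\<^sub>R mat 1) x))"
  shows "integrable M (\<lambda>w. \<Prod>b\<in>Basis. (X w \<bullet> b) ^ k b)"
    and "(\<integral>w. (\<Prod>b\<in>Basis. (X w \<bullet> b) ^ k b) \<partial>M) = (\<Prod>b\<in>Basis. \<integral>x. normal_density 0 \<tau> x * x ^ k b \<partial>lborel)"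
proof -
  have int: "integrable lborel (\<lambda>x. normal_density 0 \<tau> x * x ^ k b)" for b
    using integrable_normal_moment[OF t, of 0 "k b"] by simp
  have nn: "0 \<le> mv_normal_density 0 (\<tau>\<^sup>2 *\<^sub>R mat 1) x" for x :: "real^'n"
    by (simp add: isotropic_normal_density_eq_prod[OF t] prod_nonneg)
  have eq: "mv_normal_density 0 (\<tau>\<^sup>2 *\<^sub>R mat 1) x * (\<Prod>b\<in>Basis. (x \<bullet> b) ^ k b)
      = (\<Prod>b\<in>Basis. normal_density 0 \<tau> (x \<bullet> b) * (x \<bullet> b) ^ k b)" for x :: "real^'n"
    by (simp add: isotropic_normal_density_eq_prod[OF t] prod.distrib)
  note prod = lborel_integral_prod[of "\<lambda>b x. normal_density 0 \<tau> x * x ^ k b", OF int]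
  have m: "(\<lambda>x::real^'n. \<Prod>b\<in>Basis. (x \<bullet> b) ^ k b) \<in> borel_measurable lborel" by measurable
  show "integrable M (\<lambda>w. \<Prod>b\<in>Basis. (X w \<bullet> b) ^ k b)"
    using distributed_integrable[OF X m nn] prod(1) by (simp add: eq)
  show "(\<integral>w. (\<Prod>b\<in>Basis. (X w \<bullet> b) ^ k b) \<partial>M) = (\<Prod>b\<in>Basis. \<integral>x. normal_density 0 \<tau> x * x ^ k b \<partial>lborel)"
    using distributed_integral[OF X m nn] prod(2) by (simp add: eq)
qed

lemma isotropic_normal_mean_cov:
  fixes X :: "'w \<Rightarrow> real^'n"
  assumes t: "0 < \<tau>"
    and X: "distributed M lborel X (\<lambda>x. ennreal (mv_normal_density 0 (\<tau>\<^sup>2 *\<^sub>R mat 1) x))"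
  shows "integrable M (\<lambda>w. X w $ i)" "(\<integral>w. X w $ i \<partial>M) = 0"
    and "integrable M (\<lambda>w. X w $ i * X w $ j)"
    and "(\<integral>w. X w $ i * X w $ j \<partial>M) = (if i = j then \<tau>\<^sup>2 else 0)"
proof -
  have m0: "(\<integral>x. normal_density 0 \<tau> x \<partial>lborel) = 1"
    using t by simp
  have m1: "(\<integral>x. normal_density 0 \<tau> x * x \<partial>lborel) = 0"
    using integral_normal_moment_nz_1[OF t, of 0] by simp
  have m2: "(\<integral>x. normal_density 0 \<tau> x * x\<^sup>2 \<partial>lborel) = \<tau>\<^sup>2"
    using integral_normal_moment_even[OF t, of 0 1] by (simp add: fact_numeral)
  have p: "(\<Prod>k\<in>UNIV. y k ^ of_bool (k = i)) = y i" for y :: "'n \<Rightarrow> real" and i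
  proof -
    have "y k ^ of_bool (k = i) = (if k = i then y k else 1)" for k by simp
    then show ?thesis by (simp only:) simp
  qed
  note cart = prod_Basis_cart inner_axis axis_eq_axis
  note 1 = isotropic_normal_moment[OF t X, of "\<lambda>b. of_bool (b = axis i 1)", unfolded cart]
  show "integrable M (\<lambda>w. X w $ i)" using 1(1) by (simp add: axis_eq_axis p)
  have "(\<integral>w. X w $ i \<partial>M) = (\<Prod>k\<in>UNIV. \<integral>x. normal_density 0 \<tau> x * x ^ of_bool (k = i) \<partial>lborel)"
    using 1(2) by (simp add: axis_eq_axis p)
  also have "\<dots> = 0"
    by (rule prod_zero) (auto simp: m1 intro!: bexI[of _ i])
  finally show "(\<integral>w. X w $ i \<partial>M) = 0" .
  note 2 = isotropic_normal_moment[OF t X, of "\<lambda>b. of_bool (b = axis i 1) + of_bool (b = axis j 1)", unfolded cart]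
  show "integrable M (\<lambda>w. X w $ i * X w $ j)"
    using 2(1) by (simp add: axis_eq_axis p power_add prod.distrib)
  have *: "(\<integral>w. X w $ i * X w $ j \<partial>M)
      = (\<Prod>k\<in>UNIV. \<integral>x. normal_density 0 \<tau> x * x ^ (of_bool (k = i) + of_bool (k = j)) \<partial>lborel)"
    using 2(2) by (simp add: axis_eq_axis p power_add prod.distrib)
  show "(\<integral>w. X w $ i * X w $ j \<partial>M) = (if i = j then \<tau>\<^sup>2 else 0)"
  proof (cases "i = j")
    case True
    have "(\<integral>x. normal_density 0 \<tau> x * x ^ (of_bool (k = i) + of_bool (k = j)) \<partial>lborel) = (if k = i then \<tau>\<^sup>2 else 1)" for k
      using True m0 m2 by (auto simp: numeral_2_eq_2)
    then show ?thesis unfolding * using True by simp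
  next
    case False
    have "(\<Prod>k\<in>UNIV. \<integral>x. normal_density 0 \<tau> x * x ^ (of_bool (k = i) + of_bool (k = j)) \<partial>lborel) = 0"
      using False by (intro prod_zero) (auto simp: m1 intro!: bexI[of _ i])
    with False show ?thesis unfolding * by simp
  qed
qed

section \<open>Second moments of the smoothed statistic\<close>

lemma borel_measurable_vec_component [measurable (raw)]:
  fixes X :: "'a \<Rightarrow> real^'n"
  assumes "X \<in> borel_measurable M"
  shows "(\<lambda>w. X w $ i) \<in> borel_measurable M"
  by (rule measurable_compose[OF assms])
     (intro borel_measurable_continuous_onI continuous_intros)

lemma integrable_mult_square_integrable:
  fixes f g :: "'a \<Rightarrow> real"
  assumes [measurable]: "f \<in> borel_measurable M" "g \<in> borel_measurable M"
    and "integrable M (\<lambda>x. (f x)\<^sup>2)" "integrable M (\<lambda>x. (g x)\<^sup>2)"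
  shows "integrable M (\<lambda>x. f x * g x)"
proof (rule Bochner_Integration.integrable_bound)
  show "integrable M (\<lambda>x. (f x)\<^sup>2 + (g x)\<^sup>2)" using assms by simp
  have "\<bar>a * b\<bar> \<le> a\<^sup>2 + b\<^sup>2" for a b :: real
  proof -
    have "2 * (\<bar>a\<bar> * \<bar>b\<bar>) \<le> a\<^sup>2 + b\<^sup>2"
      using sum_squares_bound[of "\<bar>a\<bar>" "\<bar>b\<bar>"] by simp
    moreover have "0 \<le> \<bar>a\<bar> * \<bar>b\<bar>" by simp
    ultimately show ?thesis unfolding abs_mult by linarith
  qed
  then show "AE x in M. norm (f x * g x) \<le> norm ((f x)\<^sup>2 + (g x)\<^sup>2)" by simp
qed measurable

lemma (in prob_space) has_cov_centered:
  fixes Y :: "'a \<Rightarrow> real^'n"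
  assumes "has_cov M Y"
  defines "X \<equiv> \<lambda>i w. Y w $ i - expectation (\<lambda>w. Y w $ i)"
  shows "integrable M (X i)" "expectation (X i) = 0"
    and "integrable M (\<lambda>w. X i w * X j w)" "expectation (\<lambda>w. X i w * X j w) = cov_matrix M Y $ i $ j"
proof -
  have Ym[measurable]: "Y \<in> borel_measurable M" and Y2: "integrable M (\<lambda>w. (Y w $ i)\<^sup>2)" for i
    using assms by (auto simp: has_cov_def)
  have Yi[measurable]: "(\<lambda>w. Y w $ i) \<in> borel_measurable M" for i
    by measurable
  have Y1: "integrable M (\<lambda>w. Y w $ i)" for i
    using Yi Y2 by (rule square_integrable_imp_integrable)
  show "integrable M (X i)" "expectation (X i) = 0"
    using Y1 by (simp_all add: X_def prob_space)
  have X2: "integrable M (\<lambda>w. (X i w)\<^sup>2)" for i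
    using Y1 Y2 by (simp add: X_def power2_diff)
  have Xm: "X i \<in> borel_measurable M" for i
    unfolding X_def by measurable
  show "integrable M (\<lambda>w. X i w * X j w)"
    using Xm X2 by (intro integrable_mult_square_integrable)
  show "expectation (\<lambda>w. X i w * X j w) = cov_matrix M Y $ i $ j"
    by (simp add: X_def cov_matrix_def)
qed

text \<open>
  Writing the centred statistic plus noise as a sum of two independent centred vectors, the mixed
  terms have expectation zero and the covariance matrices add up.
\<close>

lemma (in prob_space) smoothed_second_moment:
  fixes T :: "'d \<Rightarrow> real^'n" and \<xi> :: "'a \<Rightarrow> real^'n"
  assumes t: "0 < \<tau>"
    and \<xi>: "distributed M lborel \<xi> (\<lambda>x. ennreal (mv_normal_density 0 (\<tau>\<^sup>2 *\<^sub>R mat 1) x))"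
    and ind: "indep_random_elements M borel \<xi> DD D"
    and T[measurable]: "T \<in> borel_measurable DD"
    and cov: "has_cov M (\<lambda>w. T (D w))"
  defines "m \<equiv> \<chi> i. expectation (\<lambda>w. T (D w) $ i)"
  shows "integrable M (\<lambda>w. (T (D w) + \<xi> w - m) $ i * (T (D w) + \<xi> w - m) $ j)"
    and "expectation (\<lambda>w. (T (D w) + \<xi> w - m) $ i * (T (D w) + \<xi> w - m) $ j)
       = cov_matrix M (\<lambda>w. T (D w)) $ i $ j + (if i = j then \<tau>\<^sup>2 else 0)"
proof -
  define X where "X i d = T d $ i - m $ i" for i d
  have Xm[measurable]: "X i \<in> borel_measurable DD" for i unfolding X_def by measurable
  note X = has_cov_centered[OF cov, folded m_def]
  have X1: "integrable M (\<lambda>w. X i (D w))" "expectation (\<lambda>w. X i (D w)) = 0" for i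
    using X(1,2)[of i] by (simp_all add: X_def m_def)
  have X2: "integrable M (\<lambda>w. X i (D w) * X j (D w))"
    "expectation (\<lambda>w. X i (D w) * X j (D w)) = cov_matrix M (\<lambda>w. T (D w)) $ i $ j" for i j
    using X(3,4)[of i j] by (simp_all add: X_def m_def)
  note N = isotropic_normal_mean_cov[OF t \<xi>]
  have cross: "integrable M (\<lambda>w. \<xi> w $ i * X j (D w))" "expectation (\<lambda>w. \<xi> w $ i * X j (D w)) = 0" for i j
    using indep_random_elements_integral_mult[OF prob_space_axioms ind, of "\<lambda>x. x $ i" "X j"] N(1,2) X1
    by simp_all
  have eq: "(T (D w) + \<xi> w - m) $ i * (T (D w) + \<xi> w - m) $ j
      = X i (D w) * X j (D w) + \<xi> w $ i * X j (D w) + \<xi> w $ j * X i (D w) + \<xi> w $ i * \<xi> w $ j" for w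
    by (simp add: X_def algebra_simps)
  show "integrable M (\<lambda>w. (T (D w) + \<xi> w - m) $ i * (T (D w) + \<xi> w - m) $ j)"
    unfolding eq by (intro Bochner_Integration.integrable_add X2 cross N)
  show "expectation (\<lambda>w. (T (D w) + \<xi> w - m) $ i * (T (D w) + \<xi> w - m) $ j)
       = cov_matrix M (\<lambda>w. T (D w)) $ i $ j + (if i = j then \<tau>\<^sup>2 else 0)"
    unfolding eq by (simp add: X2 cross N)
qed

lemma expectation_norm_matrix_vector_squared:
  fixes B :: "real^'n^'m" and Z :: "'w \<Rightarrow> real^'n"
  assumes int: "\<And>i j. integrable M (\<lambda>w. Z w $ i * Z w $ j)"
    and V: "\<And>i j. (\<integral>w. Z w $ i * Z w $ j \<partial>M) = V $ i $ j"
  shows "integrable M (\<lambda>w. (norm (B *v Z w))\<^sup>2)"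
    and "(\<integral>w. (norm (B *v Z w))\<^sup>2 \<partial>M) = trace (B ** V ** transpose B)"
proof -
  have eq: "(norm (B *v z))\<^sup>2 = (\<Sum>k\<in>UNIV. \<Sum>j\<in>UNIV. \<Sum>i\<in>UNIV. B $ k $ i * B $ k $ j * (z $ i * z $ j))"
    for z :: "real^'n"
  proof -
    have "(norm (B *v z))\<^sup>2 = (\<Sum>k\<in>UNIV. (\<Sum>j\<in>UNIV. B $ k $ j * z $ j) * (\<Sum>i\<in>UNIV. B $ k $ i * z $ i))"
      by (simp add: power2_norm_eq_inner inner_vec_def matrix_vector_mult_def)
    then show ?thesis by (simp add: sum_product mult_ac)
  qed
  show "integrable M (\<lambda>w. (norm (B *v Z w))\<^sup>2)"
    unfolding eq by (intro Bochner_Integration.integrable_sum integrable_mult_right int)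
  have "(\<integral>w. (norm (B *v Z w))\<^sup>2 \<partial>M) = (\<Sum>k\<in>UNIV. \<Sum>j\<in>UNIV. \<Sum>i\<in>UNIV. B $ k $ i * B $ k $ j * V $ i $ j)"
    unfolding eq by (simp add: int V)
  also have "\<dots> = trace (B ** V ** transpose B)"
    by (simp add: trace_def matrix_matrix_mult_def transpose_def sum_distrib_left mult_ac)
  finally show "(\<integral>w. (norm (B *v Z w))\<^sup>2 \<partial>M) = trace (B ** V ** transpose B)" .
qed

text \<open>
  The quadratic form of the covariance matrix at \<open>x\<close> is the second moment of the centred linear
  statistic with coefficients \<open>x\<close>.
\<close>

lemma (in prob_space) cov_matrix_psd:
  fixes Y :: "'a \<Rightarrow> real^'n"
  assumes "has_cov M Y"
  shows "0 \<le> x \<bullet> (cov_matrix M Y *v x)"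
proof -
  define X where "X i w = Y w $ i - expectation (\<lambda>w. Y w $ i)" for i w
  note X = has_cov_centered(3,4)[OF assms, folded X_def]
  have "x \<bullet> (cov_matrix M Y *v x) = (\<Sum>i\<in>UNIV. \<Sum>j\<in>UNIV. x $ i * x $ j * expectation (\<lambda>w. X i w * X j w))"
    by (simp add: X inner_vec_def matrix_vector_mult_def sum_distrib_left mult_ac)
  also have "\<dots> = expectation (\<lambda>w. \<Sum>i\<in>UNIV. \<Sum>j\<in>UNIV. x $ i * x $ j * (X i w * X j w))"
    using X(1) by simp
  also have "\<dots> = expectation (\<lambda>w. (\<Sum>i\<in>UNIV. x $ i * X i w)\<^sup>2)"
    by (simp add: power2_eq_square sum_product mult_ac)
  also have "\<dots> \<ge> 0" by (intro integral_nonneg_AE) simp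
  finally show ?thesis .
qed

lemma transpose_cov_matrix: "transpose (cov_matrix M Y) = cov_matrix M Y"
  by (simp add: cov_matrix_def transpose_def vec_eq_iff mult.commute)

lemma (in prob_space) trace_cov_matrix_nonneg:
  assumes "has_cov M Y"
  shows "0 \<le> trace (cov_matrix M Y)"
  unfolding trace_def by (intro sum_nonneg) (simp add: cov_matrix_def)

section \<open>Selection from a smoothed statistic\<close>

text \<open>
  Conditionally on the data \<open>D = d\<close>, the smoothed statistic \<open>W = T d + \<xi>\<close> has density
  \<open>\<phi> (x - T d)\<close>. The factor \<open>r W / \<phi> \<xi>\<close> is therefore the likelihood ratio that replaces this
  conditional density by a fixed reference density \<open>r\<close>, and so makes \<open>W\<close> independent of \<open>D\<close>. Once it
  is in place, Tonelli's theorem allows integrating over the data with \<open>W\<close> and the randomisation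
  \<open>U\<close> held fixed, where the bound on \<open>h\<close> applies.
\<close>

lemma (in prob_space) smoothed_likelihood_ratio_bound:
  fixes T :: "'d \<Rightarrow> 'e::euclidean_space" and \<xi> :: "'a \<Rightarrow> 'e" and \<phi> r :: "'e \<Rightarrow> real"
    and h :: "'u \<Rightarrow> 'd \<Rightarrow> 'e \<Rightarrow> ennreal"
  assumes \<xi>: "distributed M lborel \<xi> (\<lambda>x. ennreal (\<phi> x))" and pos: "\<And>x. 0 < \<phi> x"
    and ind: "indep_random_elements M borel \<xi> DD D"
    and indU: "indep_random_elements M UU U (DD \<Otimes>\<^sub>M borel) (\<lambda>w. (D w, \<xi> w))"
    and T[measurable]: "T \<in> borel_measurable DD"
    and [measurable]: "\<phi> \<in> borel_measurable borel" "r \<in> borel_measurable borel"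
    and nn: "\<And>x. 0 \<le> r x" and r: "(\<integral>\<^sup>+x. ennreal (r x) \<partial>lborel) \<le> 1"
    and h[measurable]: "(\<lambda>(u, d, x). h u d x) \<in> borel_measurable (UU \<Otimes>\<^sub>M (DD \<Otimes>\<^sub>M borel))"
    and h1: "\<And>u x. u \<in> space UU \<Longrightarrow> (\<integral>\<^sup>+w. h u (D w) x \<partial>M) \<le> 1"
  shows "(\<integral>\<^sup>+w. h (U w) (D w) (T (D w) + \<xi> w) * ennreal (r (T (D w) + \<xi> w) / \<phi> (\<xi> w)) \<partial>M) \<le> 1"
proof -
  have D[measurable]: "D \<in> measurable M DD" and \<xi>m[measurable]: "\<xi> \<in> borel_measurable M"
    and U[measurable]: "U \<in> measurable M UU"
    using ind indU by (auto simp: indep_random_elements_def)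
  define \<mu> where "\<mu> = distr M DD D"
  define \<nu> where "\<nu> = distr M UU U"
  define \<gamma> where "\<gamma> = distr M borel \<xi>"
  interpret mu: prob_space \<mu> unfolding \<mu>_def by (rule prob_space_distr) fact
  interpret nu: prob_space \<nu> unfolding \<nu>_def by (rule prob_space_distr) fact
  interpret ga: prob_space \<gamma> unfolding \<gamma>_def by (rule prob_space_distr) fact
  interpret gm: pair_prob_space \<gamma> \<mu> ..
  interpret ml: pair_sigma_finite \<mu> lborel ..
  have s[measurable_cong]: "sets \<mu> = sets DD" "sets \<nu> = sets UU" "sets \<gamma> = sets borel"
    by (auto simp: \<mu>_def \<nu>_def \<gamma>_def)
  have \<gamma>: "\<gamma> = density lborel (\<lambda>x. ennreal (\<phi> x))"
    using distributed_distr_eq_density[OF \<xi>] unfolding \<gamma>_def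
    by (metis distr_cong sets_lborel)
  have joint: "\<gamma> \<Otimes>\<^sub>M \<mu> = distr M (borel \<Otimes>\<^sub>M DD) (\<lambda>w. (\<xi> w, D w))"
    unfolding \<gamma>_def \<mu>_def by (rule indep_random_elements_distr[OF prob_space_axioms ind])
  define \<kappa> where "\<kappa> = distr M (DD \<Otimes>\<^sub>M borel) (\<lambda>w. (D w, \<xi> w))"
  interpret ka: prob_space \<kappa> unfolding \<kappa>_def by (rule prob_space_distr) measurable
  have [measurable_cong]: "sets \<kappa> = sets (DD \<Otimes>\<^sub>M borel)" by (simp add: \<kappa>_def)
  have jointU: "\<nu> \<Otimes>\<^sub>M \<kappa> = distr M (UU \<Otimes>\<^sub>M (DD \<Otimes>\<^sub>M borel)) (\<lambda>w. (U w, D w, \<xi> w))"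
    unfolding \<nu>_def \<kappa>_def by (rule indep_random_elements_distr[OF prob_space_axioms indU])
  define F where "F u d z = h u d (T d + z) * ennreal (r (T d + z) / \<phi> z)" for u d z
  have F[measurable]: "(\<lambda>(u, d, z). F u d z) \<in> borel_measurable (UU \<Otimes>\<^sub>M (DD \<Otimes>\<^sub>M borel))"
  proof -
    have "(\<lambda>p. h (fst p) (fst (snd p)) (T (fst (snd p)) + snd (snd p))) \<in> borel_measurable (UU \<Otimes>\<^sub>M (DD \<Otimes>\<^sub>M borel))"
      using measurable_compose[OF _ h, of "\<lambda>p. (fst p, fst (snd p), T (fst (snd p)) + snd (snd p))"]
      by simp
    then show ?thesis unfolding F_def split_beta by measurable
  qed
  have Fu[measurable]: "(\<lambda>(d, z). F u d z) \<in> borel_measurable (DD \<Otimes>\<^sub>M borel)" if "u \<in> space UU" for u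
    using measurable_compose[OF measurable_Pair1' F] that by simp
  have hu[measurable]: "(\<lambda>(d, z). h u d z) \<in> borel_measurable (DD \<Otimes>\<^sub>M borel)" if "u \<in> space UU" for u
    using measurable_compose[OF measurable_Pair1' h] that by simp
  have hud[measurable]: "(\<lambda>z. h u d z) \<in> borel_measurable borel" if "u \<in> space UU" "d \<in> space DD" for u d
    using measurable_compose[OF measurable_Pair1' hu] that by simp
  have huz[measurable]: "(\<lambda>d. h u d z) \<in> borel_measurable DD" if "u \<in> space UU" for u z
    using measurable_compose[OF measurable_Pair2' hu] that by simp
  have "(\<integral>\<^sup>+w. F (U w) (D w) (\<xi> w) \<partial>M) = (\<integral>\<^sup>+p. (\<lambda>(u, d, z). F u d z) p \<partial>(\<nu> \<Otimes>\<^sub>M \<kappa>))"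
    unfolding jointU by (subst nn_integral_distr) simp_all
  also have "\<dots> = (\<integral>\<^sup>+u. \<integral>\<^sup>+p. (\<lambda>(d, z). F u d z) p \<partial>\<kappa> \<partial>\<nu>)"
    by (subst ka.nn_integral_fst[symmetric]) simp_all
  also have "\<dots> \<le> (\<integral>\<^sup>+u. 1 \<partial>\<nu>)"
  proof (intro nn_integral_mono)
    fix u assume "u \<in> space \<nu>"
    then have u[simp]: "u \<in> space UU" by (simp add: \<nu>_def)
    have "(\<integral>\<^sup>+p. (\<lambda>(d, z). F u d z) p \<partial>\<kappa>) = (\<integral>\<^sup>+w. F u (D w) (\<xi> w) \<partial>M)"
      unfolding \<kappa>_def by (subst nn_integral_distr) simp_all
    also have "\<dots> = (\<integral>\<^sup>+p. (\<lambda>(z, d). F u d z) p \<partial>(\<gamma> \<Otimes>\<^sub>M \<mu>))"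
      unfolding joint by (subst nn_integral_distr) simp_all
    also have "\<dots> = (\<integral>\<^sup>+d. \<integral>\<^sup>+z. F u d z \<partial>\<gamma> \<partial>\<mu>)"
      by (subst gm.nn_integral_snd[symmetric]) simp_all
    also have "\<dots> = (\<integral>\<^sup>+d. \<integral>\<^sup>+x. h u d x * ennreal (r x) \<partial>lborel \<partial>\<mu>)"
    proof (intro nn_integral_cong)
      fix d assume "d \<in> space \<mu>"
      then have d[simp]: "d \<in> space DD" by (simp add: \<mu>_def)
      have "(\<integral>\<^sup>+z. F u d z \<partial>\<gamma>) = (\<integral>\<^sup>+z. ennreal (\<phi> z) * F u d z \<partial>lborel)"
        unfolding \<gamma> by (rule nn_integral_density) (simp_all add: F_def)
      also have "\<dots> = (\<integral>\<^sup>+z. h u d (T d + z) * ennreal (r (T d + z)) \<partial>lborel)"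
      proof (intro nn_integral_cong)
        fix z
        have "ennreal (\<phi> z) * ennreal (r (T d + z) / \<phi> z) = ennreal (r (T d + z))"
          using pos[of z] nn[of "T d + z"] by (simp flip: ennreal_mult)
        then show "ennreal (\<phi> z) * F u d z = h u d (T d + z) * ennreal (r (T d + z))"
          unfolding F_def by (metis mult.left_commute)
      qed
      also have "\<dots> = (\<integral>\<^sup>+x. h u d x * ennreal (r x) \<partial>lborel)"
        by (rule nn_integral_lborel_translate[of "\<lambda>x. h u d x * ennreal (r x)"]) simp
      finally show "(\<integral>\<^sup>+z. F u d z \<partial>\<gamma>) = (\<integral>\<^sup>+x. h u d x * ennreal (r x) \<partial>lborel)" .
    qed
    also have "\<dots> = (\<integral>\<^sup>+x. \<integral>\<^sup>+d. h u d x * ennreal (r x) \<partial>\<mu> \<partial>lborel)"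
      by (subst ml.Fubini') simp_all
    also have "\<dots> \<le> (\<integral>\<^sup>+x. ennreal (r x) \<partial>lborel)"
    proof (intro nn_integral_mono)
      fix x
      have "(\<integral>\<^sup>+d. h u d x \<partial>\<mu>) \<le> 1"
        using h1[OF u, of x] unfolding \<mu>_def by (subst nn_integral_distr) simp_all
      then have "(\<integral>\<^sup>+d. h u d x \<partial>\<mu>) * ennreal (r x) \<le> 1 * ennreal (r x)"
        by (rule mult_right_mono) simp
      then show "(\<integral>\<^sup>+d. h u d x * ennreal (r x) \<partial>\<mu>) \<le> ennreal (r x)"
        by (subst nn_integral_multc) simp_all
    qed
    finally show "(\<integral>\<^sup>+p. (\<lambda>(d, z). F u d z) p \<partial>\<kappa>) \<le> 1" using r by simp
  qed
  also have "\<dots> = 1" by (simp add: nu.emeasure_space_1)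
  finally show ?thesis by (simp add: F_def)
qed

text \<open>
  The bound obtained from one Gaussian reference law of the smoothed statistic: it is centred at the
  mean \<open>m\<close> of the statistic and makes \<open>B *v (W - m)\<close> isotropic with variance \<open>\<tau>\<^sup>2\<close>. The expression
  divided by two under the root is the expected log-likelihood ratio \<open>L\<close> between the conditional
  law of \<open>W\<close> given the data and this reference law. Leaving \<open>B\<close> free permits two different choices
  for the two claims of the theorem. Under the reference law the selected object is independent of
  the data, so the fixed-target guarantee and Hoeffding's lemma apply to it.
\<close>

lemma (in prob_space) selection_error_bound_reference:
  fixes T :: "'d \<Rightarrow> real^'q" and \<xi> :: "'a \<Rightarrow> real^'q" and B :: "real^'q^'q"
  assumes t: "0 < \<tau>"
    and \<xi>: "distributed M lborel \<xi> (\<lambda>x. ennreal (mv_normal_density 0 (\<tau>\<^sup>2 *\<^sub>R mat 1) x))"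
    and ind: "indep_random_elements M borel \<xi> DD D"
    and indU: "indep_random_elements M UU U (DD \<Otimes>\<^sub>M borel) (\<lambda>w. (D w, \<xi> w))"
    and T[measurable]: "T \<in> borel_measurable DD"
    and cov: "has_cov M (\<lambda>w. T (D w))"
    and A[measurable]: "A \<in> measurable (borel \<Otimes>\<^sub>M UU) SS"
    and N[measurable]: "N \<in> sets (SS \<Otimes>\<^sub>M DD)"
    and le: "\<And>s. s \<in> space SS \<Longrightarrow> prob {w \<in> space M. (s, D w) \<in> N} \<le> \<alpha>"
    and B: "det B \<noteq> 0"
  defines "V \<equiv> mat 1 + inverse (\<tau>\<^sup>2) *\<^sub>R cov_matrix M (\<lambda>w. T (D w))"
  shows "prob {w \<in> space M. (A (T (D w) + \<xi> w, U w), D w) \<in> N}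
    \<le> \<alpha> + sqrt (((trace (B ** V ** transpose B) - real CARD('q)) / 2 - ln \<bar>det B\<bar>) / 2)"
proof -
  have D[measurable]: "D \<in> measurable M DD" and \<xi>m[measurable]: "\<xi> \<in> borel_measurable M"
    and U[measurable]: "U \<in> measurable M UU"
    using ind indU by (auto simp: indep_random_elements_def)
  define m where "m = (\<chi> i. expectation (\<lambda>w. T (D w) $ i))"
  define c where "c = sqrt (2 * pi * \<tau>\<^sup>2) ^ CARD('q)"
  have c: "0 < c" using t by (simp add: c_def)
  define \<phi> where "\<phi> x = exp (- (norm x)\<^sup>2 / (2 * \<tau>\<^sup>2)) / c" for x :: "real^'q"
  define r where "r x = \<bar>det B\<bar> * \<phi> (B *v (x - m))" for x
  have \<phi>_pos: "0 < \<phi> x" for x using c by (simp add: \<phi>_def)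
  have [measurable]: "\<phi> \<in> borel_measurable borel" unfolding \<phi>_def by measurable
  have [measurable]: "r \<in> borel_measurable borel" unfolding r_def by measurable
  have r_nn: "0 \<le> r x" for x using \<phi>_pos[of "B *v (x - m)"] by (simp add: r_def)
  have \<xi>': "distributed M lborel \<xi> (\<lambda>x. ennreal (\<phi> x))"
    using \<xi> by (simp add: isotropic_normal_density_eq[OF t] \<phi>_def c_def)
  have "(\<integral>\<^sup>+x. ennreal (r x) \<partial>lborel) = (\<integral>\<^sup>+x. ennreal (r (m + x)) \<partial>lborel)"
    by (rule nn_integral_lborel_translate[symmetric]) simp
  also have "\<dots> = ennreal \<bar>det B\<bar> * (\<integral>\<^sup>+x. ennreal (\<phi> (B *v x)) \<partial>lborel)"
    using \<phi>_pos by (simp add: r_def ennreal_mult less_imp_le nn_integral_cmult)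
  also have "\<dots> = (\<integral>\<^sup>+x. ennreal (\<phi> x) \<partial>lborel)"
    using B by (rule nn_integral_lborel_matrix) simp
  also have "\<dots> = 1"
    using distributed_nn_integral[OF \<xi>', of "\<lambda>_. 1"] by (simp add: emeasure_space_1)
  \<comment> \<open>Hence the reference density is normalised.\<close>
  finally have r_int: "(\<integral>\<^sup>+x. ennreal (r x) \<partial>lborel) \<le> 1" by simp
  define Z where "Z w = T (D w) + \<xi> w - m" for w
  define L where "L w = ((norm (B *v Z w))\<^sup>2 - (norm (\<xi> w))\<^sup>2) / (2 * \<tau>\<^sup>2) - ln \<bar>det B\<bar>" for w
  have ratio: "exp (- L w) = r (T (D w) + \<xi> w) / \<phi> (\<xi> w)" for w
  proof -
    define a b where "a = - (norm (B *v Z w))\<^sup>2 / (2 * \<tau>\<^sup>2)" and "b = - (norm (\<xi> w))\<^sup>2 / (2 * \<tau>\<^sup>2)"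
    have "- L w = ln \<bar>det B\<bar> + (a - b)"
      by (simp add: L_def a_def b_def diff_divide_distrib)
    then have "exp (- L w) = \<bar>det B\<bar> * (exp a / exp b)"
      using B by (simp only: exp_add exp_diff) simp
    also have "\<dots> = \<bar>det B\<bar> * (exp a / c) / (exp b / c)"
      using c by simp
    also have "\<dots> = r (T (D w) + \<xi> w) / \<phi> (\<xi> w)"
      by (simp only: r_def \<phi>_def Z_def a_def b_def)
    finally show ?thesis .
  qed
  have Z2: "integrable M (\<lambda>w. Z w $ i * Z w $ j)" "expectation (\<lambda>w. Z w $ i * Z w $ j) = (\<tau>\<^sup>2 *\<^sub>R V) $ i $ j" for i j
    using smoothed_second_moment[OF t \<xi> ind T cov, of i j] t unfolding m_def[symmetric] Z_def
    by (auto simp: V_def mat_def algebra_simps)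
  have BZ: "integrable M (\<lambda>w. (norm (B *v Z w))\<^sup>2)"
    "expectation (\<lambda>w. (norm (B *v Z w))\<^sup>2) = \<tau>\<^sup>2 * trace (B ** V ** transpose B)"
    using expectation_norm_matrix_vector_squared[OF Z2, of B]
    by (simp_all add: trace_def sum_distrib_left matrix_scalar_ac scalar_matrix_assoc[symmetric])
  have \<xi>2: "integrable M (\<lambda>w. (norm (\<xi> w))\<^sup>2)" "expectation (\<lambda>w. (norm (\<xi> w))\<^sup>2) = real CARD('q) * \<tau>\<^sup>2"
    using isotropic_normal_mean_cov(3,4)[OF t \<xi>]
    by (simp_all add: power2_norm_eq_inner inner_vec_def)
  have L: "integrable M L" unfolding L_def using BZ \<xi>2 by simp
  have EL: "expectation L = (trace (B ** V ** transpose B) - real CARD('q)) / 2 - ln \<bar>det B\<bar>"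
    unfolding L_def using BZ \<xi>2 t by (simp add: prob_space diff_divide_distrib)
  define E where "E = {w \<in> space M. (A (T (D w) + \<xi> w, U w), D w) \<in> N}"
  have E[measurable]: "E \<in> events"
    unfolding E_def by measurable
  have "prob E - \<alpha> \<le> sqrt (expectation L / 2)"
  proof (rule prob_excess_le_sqrt[OF E L])
    fix l :: real assume l: "0 \<le> l"
    define h where "h u d x = ennreal (exp (l * (indicator N (A (x, u), d) - \<alpha>) - l\<^sup>2 / 8))" for u d x
    have h_meas: "(\<lambda>(u, d, x). h u d x) \<in> borel_measurable (UU \<Otimes>\<^sub>M (DD \<Otimes>\<^sub>M borel))"
      unfolding h_def by measurable
    have h1: "(\<integral>\<^sup>+w. h u (D w) x \<partial>M) \<le> 1" if u: "u \<in> space UU" for u x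
    proof -
      define s where "s = A (x, u)"
      have s: "s \<in> space SS"
        unfolding s_def using measurable_space[OF A, of "(x, u)"] u by (simp add: space_pair_measure)
      define S where "S = {w \<in> space M. (s, D w) \<in> N}"
      have S: "S \<in> events" unfolding S_def using s by measurable
      have "(\<integral>\<^sup>+w. h u (D w) x \<partial>M) = (\<integral>\<^sup>+w. ennreal (exp (l * (indicator S w - \<alpha>) - l\<^sup>2 / 8)) \<partial>M)"
        by (intro nn_integral_cong) (simp add: h_def S_def s_def indicator_def)
      also have "\<dots> \<le> 1"
        using S le[OF s] l unfolding S_def by (rule nn_integral_exp_indicator_le_1)
      finally show ?thesis .
    qed
    have "(\<integral>\<^sup>+w. ennreal (exp (l * (indicator E w - \<alpha>) - l\<^sup>2 / 8 - L w)) \<partial>M)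
        = (\<integral>\<^sup>+w. h (U w) (D w) (T (D w) + \<xi> w) * ennreal (r (T (D w) + \<xi> w) / \<phi> (\<xi> w)) \<partial>M)"
    proof (intro nn_integral_cong)
      fix w assume w: "w \<in> space M"
      have "exp (l * (indicator E w - \<alpha>) - l\<^sup>2 / 8 - L w) = exp (l * (indicator E w - \<alpha>) - l\<^sup>2 / 8) * exp (- L w)"
        by (simp flip: exp_add)
      moreover have "indicat_real E w = indicator N (A (T (D w) + \<xi> w, U w), D w)"
        using w by (simp add: E_def indicator_def)
      ultimately show "ennreal (exp (l * (indicator E w - \<alpha>) - l\<^sup>2 / 8 - L w))
          = h (U w) (D w) (T (D w) + \<xi> w) * ennreal (r (T (D w) + \<xi> w) / \<phi> (\<xi> w))"
        by (simp add: h_def ratio[symmetric] ennreal_mult)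
    qed
    also have "\<dots> \<le> 1"
      by (rule smoothed_likelihood_ratio_bound[OF \<xi>' \<phi>_pos ind indU T _ _ r_nn r_int h_meas h1]) simp_all
    finally show "(\<integral>\<^sup>+w. ennreal (exp (l * (indicator E w - \<alpha>) - l\<^sup>2 / 8 - L w)) \<partial>M) \<le> 1" .
  qed
  then show ?thesis by (simp add: EL E_def)
qed

theorem proposition2:
  fixes PP :: "'p set" and Pr :: "'p \<Rightarrow> 'w measure" and P :: 'p
    and DD :: "'d measure" and SS :: "'s measure" and UU :: "'u measure"
    and D :: "'w \<Rightarrow> 'd" and \<theta> :: "'s \<Rightarrow> 'p \<Rightarrow> real" and C :: "'s \<Rightarrow> 'd \<Rightarrow> real set"
    and T :: "'d \<Rightarrow> real ^ 'q" and \<xi> W :: "'w \<Rightarrow> real ^ 'q" and U :: "'w \<Rightarrow> 'u"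
    and \<A> :: "(real ^ 'q) \<times> 'u \<Rightarrow> 's" and Sstar :: "'w \<Rightarrow> 's"
    and \<tau> \<alpha> :: real and \<Sigma>T :: "real ^ 'q ^ 'q"
  assumes "\<And>Q. Q \<in> PP \<Longrightarrow> prob_space (Pr Q)"
    and "\<And>Q. Q \<in> PP \<Longrightarrow> D \<in> measurable (Pr Q) DD"
    and "standard_borel SS"
    and "\<And>Q. Q \<in> PP \<Longrightarrow>
          {(s, d). s \<in> space SS \<and> d \<in> space DD \<and> \<theta> s Q \<notin> C s d} \<in> sets (SS \<Otimes>\<^sub>M DD)"
    and "P \<in> PP" and "\<tau> > 0" and "0 \<le> \<alpha>" and "\<alpha> \<le> 1"
    and "T \<in> borel_measurable DD"
    and "distributed (Pr P) lborel \<xi> (\<lambda>x. ennreal (mv_normal_density 0 (\<tau>\<^sup>2 *\<^sub>R mat 1) x))"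
    and "indep_random_elements (Pr P) borel \<xi> DD D"
    and "W = (\<lambda>w. T (D w) + \<xi> w)"
    and "indep_random_elements (Pr P) UU U (DD \<Otimes>\<^sub>M borel) (\<lambda>w. (D w, \<xi> w))"
    and "\<A> \<in> measurable (borel \<Otimes>\<^sub>M UU) SS"
    and "Sstar = (\<lambda>w. \<A> (W w, U w))"
    and "has_cov (Pr P) (\<lambda>w. T (D w))"
    and "\<Sigma>T = cov_matrix (Pr P) (\<lambda>w. T (D w))"
    and "\<And>s. s \<in> space SS \<Longrightarrow>
          measure (Pr P) {w \<in> space (Pr P). \<theta> s P \<notin> C s (D w)} \<le> \<alpha>"
  shows "measure (Pr P) {w \<in> space (Pr P). \<theta> (Sstar w) P \<notin> C (Sstar w) (D w)}
           \<le> \<alpha> + sqrt (1 / 4 * ln (det (mat 1 + inverse (\<tau>\<^sup>2) *\<^sub>R \<Sigma>T))) \<and>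
         (\<forall>v. trace \<Sigma>T \<le> v \<longrightarrow>
           measure (Pr P) {w \<in> space (Pr P). \<theta> (Sstar w) P \<notin> C (Sstar w) (D w)}
             \<le> \<alpha> + sqrt (real CARD('q) / 4 * ln (1 + v / (real CARD('q) * \<tau>\<^sup>2))))"
proof -
  let ?M = "Pr P" and ?q = "real CARD('q)"
  interpret prob_space ?M using assms(1,5) .
  note t = assms(6) and cov = assms(16)
  have D[measurable]: "D \<in> measurable ?M DD" and U[measurable]: "U \<in> measurable ?M UU"
    and \<xi>m[measurable]: "\<xi> \<in> borel_measurable ?M"
    using assms(11,13) by (auto simp: indep_random_elements_def)
  define N where "N = {(s, d). s \<in> space SS \<and> d \<in> space DD \<and> \<theta> s P \<notin> C s d}"
  have N: "N \<in> sets (SS \<Otimes>\<^sub>M DD)" unfolding N_def using assms(4,5) .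
  have NI: "(s, D w) \<in> N \<longleftrightarrow> \<theta> s P \<notin> C s (D w)" if "s \<in> space SS" "w \<in> space ?M" for s w
    using that measurable_space[OF D] by (auto simp: N_def)
  have le: "prob {w \<in> space ?M. (s, D w) \<in> N} \<le> \<alpha>" if "s \<in> space SS" for s
    using assms(18)[OF that] that by (simp add: NI cong: conj_cong)
  define bad where "bad = {w \<in> space ?M. \<theta> (Sstar w) P \<notin> C (Sstar w) (D w)}"
  have Sstar: "Sstar w \<in> space SS" if "w \<in> space ?M" for w
    unfolding assms(15) using that measurable_space[OF assms(14), of "(W w, U w)"] measurable_space[OF U]
    by (simp add: space_pair_measure)
  have bad: "bad = {w \<in> space ?M. (\<A> (T (D w) + \<xi> w, U w), D w) \<in> N}"
    unfolding bad_def using NI[OF Sstar] by (auto simp: assms(12,15))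
  \<comment> \<open>The covariance matrix of the smoothed statistic is \<open>\<tau>\<^sup>2 *\<^sub>R V\<close>.\<close>
  define V where "V = mat 1 + inverse (\<tau>\<^sup>2) *\<^sub>R \<Sigma>T"
  have main: "prob bad \<le> \<alpha> + sqrt (((trace (B ** V ** transpose B) - ?q) / 2 - ln \<bar>det B\<bar>) / 2)"
    if "det B \<noteq> 0" for B :: "real^'q^'q"
    unfolding bad V_def assms(17)
    by (rule selection_error_bound_reference[OF t assms(10,11,13,9,16,14) N le that])
  have "transpose V = V"
    using transpose_cov_matrix[of ?M "\<lambda>w. T (D w)"]
    by (simp add: V_def assms(17) transpose_def mat_def vec_eq_iff)
  moreover have "0 < x \<bullet> (V *v x)" if "x \<noteq> 0" for x
  proof -
    have "x \<bullet> (V *v x) = x \<bullet> x + inverse (\<tau>\<^sup>2) * (x \<bullet> (\<Sigma>T *v x))"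
      by (simp add: V_def matrix_vector_mult_add_rdistrib inner_add_right scaleR_matrix_vector_assoc[symmetric])
    moreover have "0 \<le> inverse (\<tau>\<^sup>2) * (x \<bullet> (\<Sigma>T *v x))"
      using cov_matrix_psd[OF cov, of x] by (simp add: assms(17))
    moreover have "0 < x \<bullet> x" using that by simp
    ultimately show ?thesis by linarith
  qed
  \<comment> \<open>First choice: whiten the smoothed statistic, so that the reference law has its exact
      covariance matrix. The trace and dimension terms cancel.\<close>
  ultimately obtain B :: "real^'q^'q" where B: "B ** V ** transpose B = mat 1"
    using congruent_to_identity by blast
  have detB: "(det B)\<^sup>2 * det V = 1"
    using arg_cong[OF B, of det] by (simp add: det_mul power2_eq_square mult_ac)
  have B0: "det B \<noteq> 0" using detB by auto
  have "0 < det V" using detB B0 by (metis zero_less_mult_pos zero_less_one zero_less_power2)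
  then have "2 * ln \<bar>det B\<bar> + ln (det V) = ln ((det B)\<^sup>2 * det V)"
    using B0 by (simp add: ln_mult ln_realpow[of "\<bar>det B\<bar>" 2, simplified])
  then have "ln \<bar>det B\<bar> = - ln (det V) / 2" by (simp add: detB)
  then have 1: "prob bad \<le> \<alpha> + sqrt (1 / 4 * ln (det V))"
    using main[OF B0] unfolding B trace_I by simp
  have 2: "prob bad \<le> \<alpha> + sqrt (?q / 4 * ln (1 + v / (?q * \<tau>\<^sup>2)))" if v: "trace \<Sigma>T \<le> v" for v
  proof -
    \<comment> \<open>Second choice: an isotropic reference law with variance \<open>c * \<tau>\<^sup>2\<close>, where \<open>c\<close> is the bound
        that \<open>v\<close> gives for the average diagonal entry of \<open>V\<close>. The trace of the covariance matrix
        then enters through the quadratic form, and its determinant does not occur.\<close>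
    define c where "c = 1 + v / (?q * \<tau>\<^sup>2)"
    have "0 \<le> v" using v trace_cov_matrix_nonneg[OF cov] by (simp add: assms(17))
    then have c: "0 < c" using t by (simp add: c_def add_pos_nonneg)
    define B where "B = (1 / sqrt c) *\<^sub>R (mat 1 :: real^'q^'q)"
    have detB: "det B = (1 / sqrt c) ^ CARD('q)"
      unfolding B_def by (subst det_diagonal) (simp_all add: mat_def)
    have "B ** V ** transpose B = (1 / c) *\<^sub>R V"
      using c by (simp add: B_def transpose_scalar matrix_scalar_ac scalar_matrix_assoc[symmetric])
    then have "trace (B ** V ** transpose B) = trace V / c"
      by (simp add: trace_def divide_inverse sum_distrib_left mult.commute)
    also have "trace V = ?q + trace \<Sigma>T / \<tau>\<^sup>2"
      by (simp add: V_def trace_def mat_def sum.distrib divide_inverse sum_distrib_left mult.commute)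
    also have "(?q + trace \<Sigma>T / \<tau>\<^sup>2) / c \<le> (?q + v / \<tau>\<^sup>2) / c"
      using v c t by (intro divide_right_mono add_left_mono) auto
    also have "?q + v / \<tau>\<^sup>2 = ?q * c"
      using t by (simp add: c_def field_simps)
    finally have tr: "trace (B ** V ** transpose B) \<le> ?q" using c by simp
    have ln: "ln \<bar>det B\<bar> = - ?q / 2 * ln c"
      using c by (simp add: detB ln_realpow ln_div ln_sqrt)
    have "prob bad \<le> \<alpha> + sqrt (((trace (B ** V ** transpose B) - ?q) / 2 - ln \<bar>det B\<bar>) / 2)"
      using c by (intro main) (simp add: detB)
    also have "\<dots> \<le> \<alpha> + sqrt (?q / 4 * ln c)"
      using tr unfolding ln by simp
    finally show ?thesis by (simp add: c_def)
  qed
  show ?thesis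
    using 1 2 unfolding bad_def V_def by blast
qed

end
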